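(* Let $\alpha_{\min},\beta_{\max},C>0$ be constants such that for every token position $i$ the following hold: (activation bounds) $\|h_{L,i}\|_2^2\ge \alpha_{\min}\, d_{\text{model}}$ and $\|x_i^{\text{int}}\|_2^2\le \beta_{\max}\, d_{\text{model}}$; (bounded logit sensitivity) (i) $\mathbb{E}_{j\sim \pi_\theta(\cdot\mid h_{L,i})}\|(J_i)_{j,:}\|_2^2\le C$ and (ii) $\|(J_i)_{a_i,:}\|_2^2\le C$, where $(J_i)_{j,:}$ is the $j$-th row of $J_i$. Then for any sampled token $a_i$ with $\pi_\theta(a_i)<1$ and advantage $\hat A_i\neq 0$, $$\frac{\|G_i^{\text{int}}\|_F^2}{\|G_i^{\text{lm}}\|_F^2}\;\le\;\mathcal{C}_{\text{struct}}\cdot\frac{1}{(1-\pi_\theta(a_i))^2},\qquad \mathcal{C}_{\text{struct}}\triangleq\frac{4\beta_{\max}C}{\alpha_{\min}}.$$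
   Context: Setting. $d_{\text{model}},d_{\text{vocab}}$ are positive integers. For each token position $i$: $h_{L,i}\in\mathbb{R}^{d_{\text{model}}}$ is the input of the output layer (lm_head) with weight $W_{\text{lm}}\in\mathbb{R}^{d_{\text{vocab}}\times d_{\text{model}}}$; the logits are $z_i=W_{\text{lm}}h_{L,i}\in\mathbb{R}^{d_{\text{vocab}}}$; the current policy is $\pi_\theta(\cdot\mid h_{L,i})=\mathrm{softmax}(z_i)$, and $\pi_\theta(a_i)$ abbreviates $\pi_\theta(a_i\mid h_{L,i})$. The sampled token is $a_i\in\{1,\dots,d_{\text{vocab}}\}$; $\pi_{\text{old}}(a_i)>0$ is a fixed number (probability under the behavior policy); $r_i=\pi_\theta(a_i)/\pi_{\text{old}}(a_i)$ is the importance ratio; $\hat A_i\in\mathbb{R}$ is a fixed advantage. Token objective (unclipped region): $\mathcal{L}_i=r_i\hat A_i$. An arbitrary intermediate linear layer has weight $W_{\text{int}}$, input $x_i^{\text{int}}\in\mathbb{R}^{d_{\text{model}}}$ and output $y_i=W_{\text{int}}x_i^{\text{int}}$. The logits depend on $W_{\text{int}}$ only through $y_i$, i.e. $z_i=F_i(y_i)$ for a map $F_i$ (the downstream network) that is differentiable at $y_i$, and $J_i=\partial z_i/\partial y_i$ is its Jacobian, with rows indexed by vocabulary entries. Gradients: $G_i^{\text{lm}}=\nabla_{W_{\text{lm}}}\mathcal{L}_i$, where $h_{L,i}$ is held fixed (it does not depend on $W_{\text{lm}}$), and $G_i^{\text{int}}=\nabla_{W_{\text{int}}}\mathcal{L}_i$,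 where $x_i^{\text{int}}$ and all other weights are held fixed. Gradients with respect to a matrix are the matrices of entrywise partial derivatives. $\|\cdot\|_F$ is the Frobenius norm. *)

theory Defs
  imports "HOL-Probability.Probability"
begin

definition softmax :: "real ^ 'v \<Rightarrow> real ^ 'v" where
  "softmax z = (\<chi> j. exp (z $ j) / (\<Sum>k\<in>UNIV. exp (z $ k)))"

lemma softmax_nonneg: "0 \<le> softmax z $ j"
  by (simp add: softmax_def sum_nonneg)

lemma sum_softmax: "(\<Sum>j\<in>UNIV. softmax z $ j) = 1"
proof -
  have "(\<Sum>k\<in>UNIV. exp (z $ k)) > 0"
    by (rule sum_pos) auto
  then show ?thesis
    by (simp add: softmax_def flip: sum_divide_distrib)
qed

definition policy :: "real ^ 'v \<Rightarrow> 'v pmf" where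
  "policy z = embed_pmf (\<lambda>j. softmax z $ j)"

lemma pmf_policy: "pmf (policy z) j = softmax z $ j"
  unfolding policy_def
proof (rule pmf_embed_pmf)
  show "(\<integral>\<^sup>+ j. ennreal (softmax z $ j) \<partial>count_space UNIV) = 1"
    by (simp add: nn_integral_count_space_finite softmax_nonneg sum_softmax)
qed (rule softmax_nonneg)

definition importance_ratio :: "real ^ 'v \<Rightarrow> 'v pmf \<Rightarrow> 'v \<Rightarrow> real" where
  "importance_ratio z \<pi>old a = pmf (policy z) a / pmf \<pi>old a"

text \<open>The unclipped per-token objective as a function of the logits \<open>z\<close>.\<close>

definition token_objective :: "real ^ 'v \<Rightarrow> 'v pmf \<Rightarrow> 'v \<Rightarrow> real \<Rightarrow> real" where
  "token_objective z \<pi>old a A = importance_ratio z \<pi>old a * A"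

text \<open>
  The matrix of entrywise partial derivatives: entry \<open>(p, q)\<close> is the derivative
  in the entry \<open>W $ p $ q\<close>, all other entries being held fixed. As with \<^const>\<open>deriv\<close>,
  the value is meaningful only where these partial derivatives exist.
\<close>

definition matrix_gradient :: "(real ^ 'n ^ 'm \<Rightarrow> real) \<Rightarrow> real ^ 'n ^ 'm \<Rightarrow> real ^ 'n ^ 'm" where
  "matrix_gradient f W =
     (\<chi> p q. deriv (\<lambda>t. f (\<chi> p' q'. if p' = p \<and> q' = q then t else W $ p' $ q')) (W $ p $ q))"

definition frobenius_norm :: "real ^ 'n ^ 'm \<Rightarrow> real" where
  "frobenius_norm M = sqrt (\<Sum>p\<in>UNIV. \<Sum>q\<in>UNIV. (M $ p $ q)\<^sup>2)"

end

theory Submission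
  imports Defs
begin

text \<open>
  Both gradients are outer products: a function of \<open>W *v x\<close> whose gradient at that point is \<open>v\<close>
  has the rank-one gradient \<open>v x\<^sup>T\<close> in \<open>W\<close>, with squared Frobenius norm \<open>\<parallel>v\<parallel>\<^sup>2 \<parallel>x\<parallel>\<^sup>2\<close>. In the
  logits the gradient of the objective is \<open>c (e\<^sub>a - \<pi>)\<close>, where \<open>c = A \<pi>(a) / \<pi>old(a)\<close>; its entry \<open>a\<close>
  alone gives norm at least \<open>\<bar>c\<bar> (1 - \<pi>(a))\<close>. Pulled back through the Jacobian it becomes
  \<open>c (J\<^sub>a - E\<^sub>j J\<^sub>j)\<close>, whose norm is at most \<open>2 \<bar>c\<bar> \<surd>C\<close> by the triangle and Jensen inequalities.
  The factor \<open>c\<close> cancels in the quotient.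
\<close>

text \<open>Entry \<open>(p, q)\<close> of the matrix touches only coordinate \<open>p\<close> of
  the product, so varying it traces a line in direction \<open>axis p 1\<close>. This turns an
  entrywise partial derivative into a derivative along a line.\<close>

lemma matrix_entry_update_mult_vector:
  fixes W :: "real ^ 'n ^ 'm"
  shows "(\<chi> p' q'. if p' = p \<and> q' = q then t else W $ p' $ q') *v x
    = W *v x + ((t - W $ p $ q) * x $ q) *\<^sub>R axis p 1"
proof -
  have "(\<Sum>j\<in>UNIV. (if i = p \<and> j = q then t else W $ i $ j) * x $ j)
    = (\<Sum>j\<in>UNIV. W $ i $ j * x $ j + (if j = q then (if i = p then (t - W $ p $ q) * x $ q else 0) else 0))"
    for i
    by (rule sum.cong) (auto simp: algebra_simps)
  then show ?thesis
    by (simp add: vec_eq_iff matrix_vector_mult_def axis_def sum.distrib)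
qed

text \<open>Chain rule along that line: it passes through \<open>W *v x\<close> at
  \<open>t = W $ p $ q\<close> with velocity \<open>x $ q\<close> in direction
  \<open>axis p 1\<close>. Differentiability of \<open>f\<close> at this single point
  suffices.\<close>

lemma matrix_gradient_mult_vector:
  fixes W :: "real ^ 'n ^ 'm"
  assumes "(f has_derivative (\<lambda>u. v \<bullet> u)) (at (W *v x))"
  shows "matrix_gradient (\<lambda>W. f (W *v x)) W = (\<chi> p q. v $ p * x $ q)"
proof -
  have "deriv (\<lambda>t. f (W *v x + ((t - W $ p $ q) * x $ q) *\<^sub>R axis p 1)) (W $ p $ q) = v $ p * x $ q"
    for p q
  proof (rule DERIV_imp_deriv)
    let ?L = "\<lambda>t. W *v x + ((t - W $ p $ q) * x $ q) *\<^sub>R axis p 1"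
    have "(?L has_derivative (\<lambda>t. (t * x $ q) *\<^sub>R axis p 1)) (at (W $ p $ q))"
      by (auto intro!: derivative_eq_intros)
    moreover have "(f has_derivative (\<lambda>u. v \<bullet> u)) (at (?L (W $ p $ q)))"
      using assms by simp
    ultimately have "((\<lambda>t. f (?L t)) has_derivative (\<lambda>t. v \<bullet> ((t * x $ q) *\<^sub>R axis p 1))) (at (W $ p $ q))"
      by (rule has_derivative_compose)
    moreover have "(\<lambda>t. v \<bullet> ((t * x $ q) *\<^sub>R axis p 1)) = (*) (v $ p * x $ q)"
      by (simp add: fun_eq_iff inner_axis)
    ultimately show "((\<lambda>t. f (?L t)) has_field_derivative v $ p * x $ q) (at (W $ p $ q))"
      by (simp only: has_field_derivative_def)
  qed
  then show ?thesis
    by (simp add: matrix_gradient_def matrix_entry_update_mult_vector)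
qed

lemma frobenius_norm_outer_product:
  fixes v :: "real ^ 'm" and x :: "real ^ 'n"
  shows "(frobenius_norm (\<chi> p q. v $ p * x $ q))\<^sup>2 = (norm v)\<^sup>2 * (norm x)\<^sup>2"
proof -
  have "(norm v)\<^sup>2 * (norm x)\<^sup>2 = (\<Sum>p\<in>UNIV. \<Sum>q\<in>UNIV. (v $ p * x $ q)\<^sup>2)"
    by (simp add: norm_vec_def L2_set_def sum_nonneg sum_product power_mult_distrib)
  then show ?thesis
    by (simp add: frobenius_norm_def sum_nonneg)
qed

lemma has_derivative_softmax_component:
  fixes z :: "real ^ 'v"
  shows "((\<lambda>z. softmax z $ a) has_derivative
    (\<lambda>u. (softmax z $ a *\<^sub>R (axis a 1 - softmax z)) \<bullet> u)) (at z)"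
proof -
  let ?S = "\<Sum>k\<in>UNIV. exp (z $ k)"
  have S: "?S > 0"
    by (rule sum_pos) auto
  have d: "((\<lambda>z :: real ^ 'v. exp (z $ k)) has_derivative (\<lambda>u. exp (z $ k) * u $ k)) (at z)" for k
    by (auto intro!: derivative_eq_intros bounded_linear_imp_has_derivative bounded_linear_vec_nth)
  have "((\<lambda>z :: real ^ 'v. exp (z $ a) / (\<Sum>k\<in>UNIV. exp (z $ k))) has_derivative
      (\<lambda>u. (exp (z $ a) * u $ a * ?S - exp (z $ a) * (\<Sum>k\<in>UNIV. exp (z $ k) * u $ k)) / (?S * ?S))) (at z)"
    using S by (intro has_derivative_divide' d has_derivative_sum) auto
  moreover have "(exp (z $ a) * u $ a * ?S - exp (z $ a) * (\<Sum>k\<in>UNIV. exp (z $ k) * u $ k)) / (?S * ?S)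
      = (softmax z $ a *\<^sub>R (axis a 1 - softmax z)) \<bullet> u" for u
  proof -
    \<comment> \<open>The subtracted term of the quotient rule is the mean of \<open>u\<close> under
      the softmax weights, scaled by \<open>softmax z $ a\<close>.\<close>
    have "softmax z \<bullet> u = (\<Sum>k\<in>UNIV. exp (z $ k) * u $ k) / ?S"
      by (simp add: inner_vec_def softmax_def sum_divide_distrib)
    then show ?thesis
      using S by (simp add: inner_diff_left inner_axis' softmax_def field_simps)
  qed
  ultimately show ?thesis
    by (simp add: softmax_def)
qed

lemma has_derivative_token_objective:
  "((\<lambda>z. token_objective z \<pi>old a A) has_derivative
    (\<lambda>u. ((A * softmax z $ a / pmf \<pi>old a) *\<^sub>R (axis a 1 - softmax z)) \<bullet> u)) (at z)"
proof -
  have "((\<lambda>z. (A / pmf \<pi>old a) * softmax z $ a) has_derivative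
    (\<lambda>u. (A / pmf \<pi>old a) * ((softmax z $ a *\<^sub>R (axis a 1 - softmax z)) \<bullet> u))) (at z)"
    by (rule has_derivative_mult_right[OF has_derivative_softmax_component])
  then show ?thesis
    by (simp add: token_objective_def importance_ratio_def pmf_policy mult_ac)
qed

text \<open>The adjoint identity \<open>g \<bullet> (J *v u) = (g v* J) \<bullet> u\<close> keeps
  the derivative in gradient form, as \<open>matrix_gradient_mult_vector\<close> expects.\<close>

lemma has_derivative_compose_jacobian:
  fixes F :: "real ^ 'k \<Rightarrow> real ^ 'v"
  assumes "F differentiable (at y)" "(f has_derivative (\<lambda>u. g \<bullet> u)) (at (F y))"
  shows "((\<lambda>y. f (F y)) has_derivative (\<lambda>u. (g v* jacobian F (at y)) \<bullet> u)) (at y)"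
proof -
  have "(F has_derivative (\<lambda>u. jacobian F (at y) *v u)) (at y)"
    using assms(1) jacobian_works by blast
  from has_derivative_compose[OF this assms(2)] show ?thesis
    by (simp add: dot_lmul_matrix)
qed

text \<open>Jensen's inequality for the squared norm: the triangle inequality reduces it to the real
  numbers \<open>norm (r j)\<close>, whose variance is nonnegative.\<close>

lemma norm_weighted_sum_power2_le:
  fixes r :: "'v \<Rightarrow> 'b::real_normed_vector"
  assumes "\<And>j. j \<in> S \<Longrightarrow> 0 \<le> s j" "sum s S = 1"
  shows "(norm (\<Sum>j\<in>S. s j *\<^sub>R r j))\<^sup>2 \<le> (\<Sum>j\<in>S. s j * (norm (r j))\<^sup>2)"
proof -
  define m where "m = (\<Sum>j\<in>S. s j * norm (r j))"
  have "norm (\<Sum>j\<in>S. s j *\<^sub>R r j) \<le> m"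
    unfolding m_def using assms(1) by (intro sum_norm_le) simp
  then have "(norm (\<Sum>j\<in>S. s j *\<^sub>R r j))\<^sup>2 \<le> m\<^sup>2"
    by (intro power_mono) auto
  \<comment> \<open>This sum is the variance of the norms about their mean \<open>m\<close>.
    Expanded with total weight 1, it equals the second moment minus the square of
    \<open>m\<close>.\<close>
  also have "0 \<le> (\<Sum>j\<in>S. s j * (norm (r j) - m)\<^sup>2)"
    using assms(1) by (intro sum_nonneg) simp
  then have "m\<^sup>2 \<le> m\<^sup>2 + (\<Sum>j\<in>S. s j * (norm (r j) - m)\<^sup>2)"
    by simp
  also have "(\<Sum>j\<in>S. s j * (norm (r j) - m)\<^sup>2)
      = (\<Sum>j\<in>S. s j * (norm (r j))\<^sup>2 - 2 * m * (s j * norm (r j)) + m\<^sup>2 * s j)"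
    by (rule sum.cong) (auto simp: power2_eq_square algebra_simps)
  also have "\<dots> = (\<Sum>j\<in>S. s j * (norm (r j))\<^sup>2) - 2 * m * m + m\<^sup>2 * sum s S"
    by (simp add: sum.distrib sum_subtractf m_def flip: sum_distrib_left)
  finally show ?thesis
    by (simp add: assms(2) power2_eq_square)
qed

text \<open>Splits the pulled-back gradient into the two quantities that the sensitivity bounds
  control: the row of the sampled token and the weighted mean of all rows.\<close>

lemma axis_minus_vector_matrix_mult:
  fixes M :: "real ^ 'k ^ 'v"
  shows "(axis a 1 - s) v* M = row a M - (\<Sum>j\<in>UNIV. s $ j *\<^sub>R row j M)"
proof -
  have "(\<Sum>i\<in>UNIV. axis a 1 $ i * M $ i $ k) = M $ a $ k" for k
    by (simp add: axis_def if_distrib[of "\<lambda>c. c * _"] cong: if_cong)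
  then have "(\<Sum>i\<in>UNIV. (axis a 1 $ i - s $ i) * M $ i $ k) = M $ a $ k - (\<Sum>i\<in>UNIV. s $ i * M $ i $ k)" for k
    by (simp add: left_diff_distrib sum_subtractf)
  then show ?thesis
    by (simp add: vec_eq_iff vector_matrix_mult_def row_def mult.commute[of "M $ _ $ _"])
qed

lemma norm_axis_minus_softmax_mult_le:
  fixes M :: "real ^ 'k ^ 'v"
  assumes "measure_pmf.expectation (policy z) (\<lambda>j. (norm (row j M))\<^sup>2) \<le> C"
    and "(norm (row a M))\<^sup>2 \<le> C"
  shows "(norm ((axis a 1 - softmax z) v* M))\<^sup>2 \<le> 4 * C"
proof -
  let ?e = "\<Sum>j\<in>UNIV. softmax z $ j *\<^sub>R row j M"
  have "(norm ?e)\<^sup>2 \<le> (\<Sum>j\<in>UNIV. softmax z $ j * (norm (row j M))\<^sup>2)"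
    by (rule norm_weighted_sum_power2_le) (simp_all add: softmax_nonneg sum_softmax)
  also have "\<dots> \<le> C"
    using assms(1) by (simp add: integral_measure_pmf[of UNIV] pmf_policy)
  finally have e: "norm ?e \<le> sqrt C"
    by (rule real_le_rsqrt)
  have "norm (row a M) \<le> sqrt C"
    using assms(2) by (rule real_le_rsqrt)
  with e have "norm (row a M - ?e) \<le> 2 * sqrt C"
    using norm_triangle_ineq4[of "row a M" ?e] by linarith
  then have "(norm (row a M - ?e))\<^sup>2 \<le> (2 * sqrt C)\<^sup>2"
    by (intro power_mono) auto
  \<comment> \<open>Needed for \<open>(2 * sqrt C)\<^sup>2\<close> to simplify to
    \<open>4 * C\<close>.\<close>
  moreover have "0 \<le> C"
    using assms(2) zero_le_power2 order_trans by blast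
  ultimately show ?thesis
    by (simp add: axis_minus_vector_matrix_mult power_mult_distrib)
qed

lemma norm_axis_minus_ge:
  fixes s :: "real ^ 'v"
  shows "1 - s $ a \<le> norm (axis a 1 - s)"
  using component_le_norm_cart[of "axis a 1 - s" a] by (simp add: axis_def)

theorem theorem1:
  fixes W_lm :: "real ^ 'm ^ 'v"
    and W_int :: "real ^ 'm ^ 'k"
    and h x :: "'i \<Rightarrow> real ^ 'm"
    and F :: "'i \<Rightarrow> real ^ 'k \<Rightarrow> real ^ 'v"
    and a :: "'i \<Rightarrow> 'v"
    and \<pi>old :: "'i \<Rightarrow> 'v pmf"
    and A :: "'i \<Rightarrow> real"
    and \<alpha>min \<beta>max C :: real
  defines "z \<equiv> \<lambda>i. W_lm *v h i"
    and "y \<equiv> \<lambda>i. W_int *v x i"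
  defines "J \<equiv> \<lambda>i. jacobian (F i) (at (y i))"
    and "G_lm \<equiv> \<lambda>i. matrix_gradient
           (\<lambda>W. token_objective (W *v h i) (\<pi>old i) (a i) (A i)) W_lm"
    and "G_int \<equiv> \<lambda>i. matrix_gradient
           (\<lambda>W. token_objective (F i (W *v x i)) (\<pi>old i) (a i) (A i)) W_int"
  assumes behavior_pos: "\<And>i. pmf (\<pi>old i) (a i) > 0"
    and logits: "\<And>i. z i = F i (y i)"
    and differentiable: "\<And>i. F i differentiable (at (y i))"
    and constants: "\<alpha>min > 0" "\<beta>max > 0" "C > 0"
    and activation_lower: "\<And>i. (norm (h i))\<^sup>2 \<ge> \<alpha>min * real CARD('m)"
    and activation_upper: "\<And>i. (norm (x i))\<^sup>2 \<le> \<beta>max * real CARD('m)"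
    and sensitivity_mean:
      "\<And>i. measure_pmf.expectation (policy (z i)) (\<lambda>j. (norm (row j (J i)))\<^sup>2) \<le> C"
    and sensitivity_token: "\<And>i. (norm (row (a i) (J i)))\<^sup>2 \<le> C"
  shows "\<forall>i. pmf (policy (z i)) (a i) < 1 \<longrightarrow> A i \<noteq> 0 \<longrightarrow>
           (frobenius_norm (G_int i))\<^sup>2 / (frobenius_norm (G_lm i))\<^sup>2
             \<le> (4 * \<beta>max * C / \<alpha>min) * (1 / (1 - pmf (policy (z i)) (a i))\<^sup>2)"
proof (intro allI impI)
  fix i
  assume lt: "pmf (policy (z i)) (a i) < 1" and A: "A i \<noteq> 0"
  let ?s = "softmax (z i)"
  define c where "c = A i * ?s $ a i / pmf (\<pi>old i) (a i)"
  let ?g = "axis (a i) 1 - ?s"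
  let ?d = "real CARD('m)"
  have s_lt: "?s $ a i < 1"
    using lt by (simp add: pmf_policy)
  have "(\<Sum>k\<in>UNIV. exp (z i $ k)) > 0"
    by (rule sum_pos) auto
  then have "?s $ a i > 0"
    by (simp add: softmax_def)
  \<comment> \<open>Softmax probabilities are strictly positive, so \<open>c\<close> vanishes only
    with the advantage. This permits its cancellation below.\<close>
  then have c: "c\<^sup>2 > 0"
    using A behavior_pos[of i] by (simp add: c_def)
  have der: "((\<lambda>z. token_objective z (\<pi>old i) (a i) (A i)) has_derivative (\<lambda>u. (c *\<^sub>R ?g) \<bullet> u)) (at (z i))"
    unfolding c_def by (rule has_derivative_token_objective)
  have "G_lm i = (\<chi> p q. (c *\<^sub>R ?g) $ p * h i $ q)"
    unfolding G_lm_def by (rule matrix_gradient_mult_vector) (use der in \<open>simp only: z_def\<close>)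
  then have lm: "(frobenius_norm (G_lm i))\<^sup>2 = c\<^sup>2 * (norm ?g)\<^sup>2 * (norm (h i))\<^sup>2"
    by (simp only: frobenius_norm_outer_product norm_scaleR power_mult_distrib power2_abs)
  \<comment> \<open>By \<open>logits\<close>, \<open>F i (y i)\<close> is the point
    \<open>z i\<close>, so the logit gradient used for the output layer serves here too.\<close>
  have "((\<lambda>y. token_objective (F i y) (\<pi>old i) (a i) (A i)) has_derivative
      (\<lambda>u. ((c *\<^sub>R ?g) v* J i) \<bullet> u)) (at (y i))"
    unfolding J_def
    by (rule has_derivative_compose_jacobian[OF differentiable]) (use der in \<open>simp only: logits\<close>)
  then have "G_int i = (\<chi> p q. ((c *\<^sub>R ?g) v* J i) $ p * x i $ q)"
    unfolding G_int_def y_def by (rule matrix_gradient_mult_vector)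
  moreover have "(c *\<^sub>R ?g) v* J i = c *\<^sub>R (?g v* J i)"
    by (rule scaleR_vector_matrix_assoc)
  ultimately have int: "(frobenius_norm (G_int i))\<^sup>2 = c\<^sup>2 * (norm (?g v* J i))\<^sup>2 * (norm (x i))\<^sup>2"
    by (simp only: frobenius_norm_outer_product norm_scaleR power_mult_distrib power2_abs)
  have "c\<^sup>2 * (norm (?g v* J i))\<^sup>2 * (norm (x i))\<^sup>2 \<le> c\<^sup>2 * (4 * C) * (\<beta>max * ?d)"
    using norm_axis_minus_softmax_mult_le[OF sensitivity_mean sensitivity_token] activation_upper constants(3)
    by (intro mult_mono mult_left_mono) auto
  moreover have "c\<^sup>2 * (1 - ?s $ a i)\<^sup>2 * (\<alpha>min * ?d) \<le> c\<^sup>2 * (norm ?g)\<^sup>2 * (norm (h i))\<^sup>2"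
    using s_lt activation_lower constants(1)
    by (intro mult_mono mult_left_mono power_mono norm_axis_minus_ge) auto
  \<comment> \<open>The lower bound of the denominator must be strictly positive to bound the
    quotient; here the sampled probability being below 1 enters.\<close>
  moreover have "0 < c\<^sup>2 * (1 - ?s $ a i)\<^sup>2 * (\<alpha>min * ?d)"
    using c s_lt constants(1) by simp
  ultimately have "(frobenius_norm (G_int i))\<^sup>2 / (frobenius_norm (G_lm i))\<^sup>2
      \<le> (c\<^sup>2 * (4 * C) * (\<beta>max * ?d)) / (c\<^sup>2 * (1 - ?s $ a i)\<^sup>2 * (\<alpha>min * ?d))"
    unfolding lm int using constants by (intro frac_le) auto
  \<comment> \<open>Besides \<open>c\<^sup>2\<close>, the dimension \<open>?d\<close> cancels, since
    \<open>h i\<close> and \<open>x i\<close> live in the same space.\<close>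
  also have "\<dots> = (4 * \<beta>max * C / \<alpha>min) * (1 / (1 - ?s $ a i)\<^sup>2)"
    using c by (simp add: mult_ac)
  finally show "(frobenius_norm (G_int i))\<^sup>2 / (frobenius_norm (G_lm i))\<^sup>2
      \<le> (4 * \<beta>max * C / \<alpha>min) * (1 / (1 - pmf (policy (z i)) (a i))\<^sup>2)"
    by (simp only: pmf_policy)
qed

end
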